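(* Let $X$ be a real (pre)-ordered Banach space, (pre)-ordered by a closed generating, not necessarily proper, cone $X^{+}$. Let $J$ be a finite set, possibly empty, and, for all $j\in J$, let $\rho_{j}:X\times X\to\mathbb{R}$ be a continuous seminorm or a continuous linear functional. Let $S_X:=\{x\in X:\|x\|=1\}$. Then: (1) There exist a constant $K>0$ and continuous positively homogeneous maps $\gamma^{+},\gamma^{-}:X\to X^{+}$ such that: (a) $x=\gamma^{+}(x)-\gamma^{-}(x)$ for all $x\in X$; (b) $\|\gamma^{+}(x)\|+\|\gamma^{-}(x)\|\leq K\|x\|$ for all $x\in X$. (2) If $K>0$ and $\alpha_{j}\in\mathbb{R}$ $(j\in J)$ are constants, then the following are equivalent: (a) For every $\varepsilon>0$, there exist maps $\gamma_{\varepsilon}^{+},\gamma_{\varepsilon}^{-}:S_{X}\to X^{+}$ such that: (i) $x=\gamma_{\varepsilon}^{+}(x)-\gamma_{\varepsilon}^{-}(x)$ for all $x\in S_{X}$; (ii) $\|\gamma_{\varepsilon}^{+}(x)\|+\|\gamma_{\varepsilon}^{-}(x)\|\leq K+\varepsilon$ for all $x\in S_{X}$; (iii) $\rho_{j}\bigl((\gamma_{\varepsilon}^{+}(x),\gamma_{\varepsilon}^{-}(x))\bigr)\leq\alpha_{j}+\varepsilon$ for all $x\in S_{X}$ and $j\in J$. (b) For every $\varepsilon>0$, there exist continuous positively homogeneous maps $\gamma_{\varepsilon}^{+},\gamma_{\varepsilon}^{-}:X\to X^{+}$ such that: (i) $x=\gamma_{\varepsilon}^{+}(x)-\gamma_{\varepsilon}^{-}(x)$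 for all $x\in X$; (ii) $\|\gamma_{\varepsilon}^{+}(x)\|+\|\gamma_{\varepsilon}^{-}(x)\|\leq(K+\varepsilon)\|x\|$ for all $x\in X$; (iii) $\rho_{j}\bigl((\gamma_{\varepsilon}^{+}(x),\gamma_{\varepsilon}^{-}(x))\bigr)\leq(\alpha_{j}+\varepsilon)\|x\|$ for all $x\in X$ and $j\in J$.
   Context: A subset $C$ of a real vector space is a cone if $C+C\subseteq C$ and $\lambda C\subseteq C$ for all $\lambda\geq 0$; it is proper if $C\cap(-C)=\{0\}$ (not assumed here). The cone $X^+$ determines the (pre)-order $x\leq y\iff y-x\in X^+$, and $X^{+}$ is generating if $X=X^{+}-X^{+}$. A map $\gamma:X\to X^+$ is positively homogeneous if $\gamma(\lambda x)=\lambda\gamma(x)$ for all $x\in X$ and $\lambda\geq0$. $X\times X$ carries the product topology. *)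

theory Defs
  imports "HOL-Analysis.Analysis"
begin

text \<open>
  A cone in the sense of being closed under addition and under nonnegative scalars is the
  library's \<^const>\<open>convex_cone\<close> (the library's \<^const>\<open>cone\<close> lacks closure under addition).
  The only difference is that the empty set is excluded, and the empty set is never generating.
\<close>

lemma convex_cone_iff_add_scaleR:
  fixes C :: "'a::real_vector set"
  shows "convex_cone C \<longleftrightarrow>
    C \<noteq> {} \<and> C + C \<subseteq> C \<and> (\<forall>c\<ge>0. (\<lambda>x. c *\<^sub>R x) ` C \<subseteq> C)"
proof
  assume "convex_cone C"
  then show "C \<noteq> {} \<and> C + C \<subseteq> C \<and> (\<forall>c\<ge>0. (\<lambda>x. c *\<^sub>R x) ` C \<subseteq> C)"
    by (auto simp: set_plus_def convex_cone_add convex_cone_scaleR convex_cone_nonempty)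
next
  assume C: "C \<noteq> {} \<and> C + C \<subseteq> C \<and> (\<forall>c\<ge>0. (\<lambda>x. c *\<^sub>R x) ` C \<subseteq> C)"
  then have add: "x + y \<in> C" if "x \<in> C" "y \<in> C" for x y
    using that by (auto simp: set_plus_def)
  have scale: "c *\<^sub>R x \<in> C" if "x \<in> C" "0 \<le> c" for c x
    using C that by blast
  have "convex C"
    by (intro convexI add scale) auto
  moreover have "conic C"
    unfolding conic_def using scale by blast
  ultimately show "convex_cone C"
    using C unfolding convex_cone_def by blast
qed

text \<open>\<open>X = C - C\<close>, spelled out because \<open>-\<close> on sets denotes the set-theoretic difference.\<close>

definition generating :: "'a::real_vector set \<Rightarrow> bool" where
  "generating C \<longleftrightarrow> UNIV = {x - y | x y. x \<in> C \<and> y \<in> C}"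

definition seminorm :: "('a::real_vector \<Rightarrow> real) \<Rightarrow> bool" where
  "seminorm p \<longleftrightarrow>
     (\<forall>x. 0 \<le> p x) \<and>
     (\<forall>x y. p (x + y) \<le> p x + p y) \<and>
     (\<forall>c x. p (c *\<^sub>R x) = \<bar>c\<bar> * p x)"

definition pos_homogeneous :: "('a::real_vector \<Rightarrow> 'b::real_vector) \<Rightarrow> bool" where
  "pos_homogeneous g \<longleftrightarrow> (\<forall>x. \<forall>c\<ge>0. g (c *\<^sub>R x) = c *\<^sub>R g x)"

end

theory Submission
  imports Defs
begin

text \<open>
  A decomposition \<open>x = a - b\<close> with \<open>a\<close>, \<open>b\<close> in the cone is a preimage of \<open>x\<close>, within the closed
  convex cone \<open>E = Xp \<times> Xp\<close>, under the bounded linear map \<open>T (a, b) = a - b\<close>. The theorem therefore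
  asks for continuous positively homogeneous right inverses of \<open>T\<close> with values in \<open>E\<close>, and
  generation of the space by \<open>Xp\<close> means that \<open>T\<close> maps \<open>E\<close> onto the space.

  The central device is averaging (\<open>continuous_local_average\<close>): a bounded map on a metric space,
  however discontinuous, can be replaced by a continuous one whose value at \<open>x\<close> lies in the closed
  convex hull of the values taken within distance \<open>\<delta>\<close> of \<open>x\<close>. Thus membership in \<open>E\<close> and upper
  bounds on continuous sublinear functionals survive, and a right inverse of \<open>T\<close> on the unit sphere
  becomes an approximate one with error at most \<open>\<delta>\<close>. The averaging weights come from a partition
  of unity obtained by well-ordering the points and taking increments of running suprema of tent
  functions. This family need not be locally finite, but its constant sum makes the averages
  continuous.

  The first part, in the form of \<open>closed_cone_continuous_right_inverse\<close>, then follows the proof of the open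
  mapping theorem. Baire's theorem gives approximate preimages in \<open>E\<close> of controlled norm; averaging
  makes them depend continuously on the point of the sphere, radial extension makes them homogeneous;
  and iterating on the remaining error, which shrinks by a factor \<open>1 / 2\<close> in each step, gives a
  uniformly convergent series of corrections.

  For the nontrivial direction of the equivalence
  (\<open>closed_cone_continuous_right_inverse_bounds\<close>) the given pointwise
  decompositions are averaged, which costs nothing in the bounds but leaves an error of norm at
  most \<open>\<delta>\<close>; composing that error with the right inverse from the first part gives an exact correction,
  whose effect on the finitely many functionals tends to \<open>0\<close> with \<open>\<delta>\<close>. The other direction is
  restriction to the sphere.
\<close>

section \<open>Partitions of unity from well-orders\<close>

text \<open>
  Reading the values of \<open>g\<close> along the well-order, \<open>y\<close> contributes the amount by which it raises the
  running supremum. The increments telescope: along a limit the supremum is by definition the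
  supremum of what came before, so nothing is lost there, and the total is the maximum of \<open>g\<close>.
  This is the source of the partitions of unity below: possibly uncountably many nonnegative functions are
  turned into functions whose sum is the pointwise maximum of the family.
\<close>

lemma has_sum_well_ordered_increments:
  fixes g :: "'i \<Rightarrow> real"
  assumes r: "well_order_on A r"
    and nonneg: "\<And>y. y \<in> A \<Longrightarrow> 0 \<le> g y"
    and a: "a \<in> A" and max: "\<And>y. y \<in> A \<Longrightarrow> g y \<le> g a"
  shows "((\<lambda>y. max 0 (g y - Sup (insert 0 (g ` underS r y)))) has_sum g a) A"
proof -
  define h where "h y = Sup (insert 0 (g ` underS r y))" for y
  define f where "f y = max 0 (g y - h y)" for y
  have wo: "wo_rel r"
    using r by (simp add: wo_rel_def well_order_on_Well_order)
  have field: "Field r = A"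
    using r well_order_on_Field by fastforce
  have trans_r: "trans r" and antisym_r: "antisym r" and refl_r: "(y, y) \<in> r" if "y \<in> A" for y
    using r that unfolding order_on_defs by (auto dest: refl_onD)
  have underS_sub: "underS r y \<subseteq> A" for y
    using field Order_Relation.underS_Field[of r y] by simp
  have under_eq: "under r y = insert y (underS r y)" if "y \<in> A" for y
    using refl_r[OF that] by (auto simp: under_def underS_def)
  have bdd: "bdd_above (insert 0 (g ` B))" if "B \<subseteq> A" for B
    using that max by (intro bdd_above_insert[THEN iffD2] bdd_aboveI2[where M = "g a"]) auto
  have h_upper: "g z \<le> h y" if "z \<in> underS r y" for z y
    unfolding h_def by (rule cSup_upper) (use that bdd[OF underS_sub] in auto)
  have h_nonneg: "0 \<le> h y" for y
    unfolding h_def by (rule cSup_upper) (use bdd[OF underS_sub] in auto)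
  have h_least: "h y \<le> b" if "0 \<le> b" "\<And>z. z \<in> underS r y \<Longrightarrow> g z \<le> b" for y b
    unfolding h_def by (rule cSup_least) (use that in auto)
  have f_nonneg: "0 \<le> f y" for y
    by (simp add: f_def)
  have greatest: "\<exists>m\<in>F. \<forall>z\<in>F. (z, m) \<in> r" if "finite F" "F \<noteq> {}" "F \<subseteq> A" for F
    using that
  proof (induction rule: finite_ne_induct)
    case (singleton x)
    then show ?case using refl_r by auto
  next
    case (insert x F)
    then obtain m where m: "m \<in> F" "\<forall>z\<in>F. (z, m) \<in> r"
      by auto
    have tot: "(x, m) \<in> r \<or> (m, x) \<in> r"
      using wo_rel.TOTALS[OF wo] field insert.prems m(1) by (metis insert_subset subsetD)
    have rx: "(x, x) \<in> r" using refl_r insert.prems by auto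
    have tr: "trans r" using trans_r insert.prems by blast
    show ?case
    proof (cases "(x, m) \<in> r")
      case True then show ?thesis using m by auto
    next
      case False
      then have "(m, x) \<in> r" using tot by auto
      then have "\<forall>z\<in>F. (z, x) \<in> r" using m tr by (meson transD)
      then show ?thesis using rx by auto
    qed
  qed
  \<comment> \<open>No finite sum exceeds the running supremum; the induction removes the last index.\<close>
  have finite_le: "sum f F \<le> b"
    if "finite F" "F \<subseteq> A" "0 \<le> b" "\<And>y. y \<in> A \<Longrightarrow> (\<exists>m\<in>F. (y, m) \<in> r) \<Longrightarrow> g y \<le> b" for F b
    using that
  proof (induction "card F" arbitrary: F b rule: less_induct)
    case less
    show ?case
    proof (cases "F = {}")
      case True
      then show ?thesis using less.prems by simp
    next
      case False
      then obtain m where m: "m \<in> F" "\<And>z. z \<in> F \<Longrightarrow> (z, m) \<in> r"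
        using greatest less.prems by meson
      have mA: "m \<in> A" using m less.prems by auto
      have below: "y \<in> underS r m" if "z \<in> F - {m}" "(y, z) \<in> r" for y z
      proof -
        have "(z, m) \<in> r" using m that by auto
        then show ?thesis
          using that trans_r[OF mA] antisym_r[OF mA] unfolding underS_def
          by (metis (mono_tags, lifting) DiffD2 antisymD insertI1 mem_Collect_eq transD)
      qed
      have "sum f (F - {m}) \<le> h m"
      proof (rule less.hyps)
        show "card (F - {m}) < card F"
          using less.prems(1) m(1) by (rule card_Diff1_less)
        show "g y \<le> h m" if "\<exists>z\<in>F - {m}. (y, z) \<in> r" for y
          using that below h_upper by blast
      qed (use less.prems h_nonneg in auto)
      moreover have "h m \<le> b"
        by (rule h_least) (use less.prems m(1) underS_sub in \<open>auto simp: underS_def\<close>)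
      moreover have "g m \<le> b"
        using less.prems mA m by blast
      moreover have "sum f F = f m + sum f (F - {m})"
        using less.prems(1) m(1) by (simp add: sum.remove)
      ultimately show ?thesis
        by (auto simp: f_def max_def)
    qed
  qed
  have ga: "0 \<le> g a" using nonneg a by auto
  have summable: "f summable_on B" if "B \<subseteq> A" for B
  proof (rule nonneg_bdd_above_summable_on)
    show "bdd_above (sum f ` {F. F \<subseteq> B \<and> finite F})"
      by (rule bdd_aboveI2[where M = "g a"]) (use that finite_le ga max in auto)
  qed (rule f_nonneg)
  \<comment> \<open>Conversely, transfinite induction shows that the sum catches up with each value of \<open>g\<close>.\<close>
  have g_le: "y \<in> A \<longrightarrow> g y \<le> infsum f (under r y)" for y
  proof (induction y rule: wo_rel.well_order_induct[OF wo])
    case (1 y)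
    show ?case
    proof
      assume y: "y \<in> A"
      have "h y \<le> infsum f (underS r y)"
      proof (rule h_least)
        show "0 \<le> infsum f (underS r y)"
          by (intro infsum_nonneg f_nonneg)
        fix z assume z: "z \<in> underS r y"
        then have zA: "z \<in> A" using underS_sub by auto
        then have "g z \<le> infsum f (under r z)"
          using 1 z by (auto simp: underS_def)
        also have "\<dots> \<le> infsum f (underS r y)"
        proof (rule infsum_mono2)
          show "under r z \<subseteq> underS r y"
            using z trans_r[OF y] antisym_r[OF y] unfolding under_def underS_def
            by (auto dest: transD antisymD)
          then show "f summable_on under r z" "f summable_on underS r y"
            using summable underS_sub by (meson order_trans)+
        qed (rule f_nonneg)
        finally show "g z \<le> infsum f (underS r y)" .
      qed
      moreover have "infsum f (under r y) = f y + infsum f (underS r y)"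
        unfolding under_eq[OF y]
        by (rule infsum_insert) (use summable[OF underS_sub] in \<open>auto simp: underS_notIn\<close>)
      ultimately show "g y \<le> infsum f (under r y)"
        by (auto simp: f_def max_def)
    qed
  qed
  have "infsum f A \<le> g a"
    by (rule infsum_le_finite_sums) (use summable finite_le max ga in auto)
  moreover have "g a \<le> infsum f A"
  proof -
    have "under r a \<subseteq> A" using under_eq[OF a] a underS_sub by auto
    then have "infsum f (under r a) \<le> infsum f A"
      by (intro infsum_mono2 summable f_nonneg) auto
    then show ?thesis using g_le a by force
  qed
  ultimately have "infsum f A = g a" by simp
  then have "(f has_sum g a) A"
    using summable has_sum_infsum by force
  then show ?thesis unfolding f_def h_def .
qed

lemma lipschitz_on_Sup_insert:
  fixes \<phi> :: "'i \<Rightarrow> 'x::metric_space \<Rightarrow> real"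
  assumes lip: "\<And>y. y \<in> B \<Longrightarrow> L-lipschitz_on S (\<phi> y)" and L: "0 \<le> L"
    and bdd: "\<And>x. x \<in> S \<Longrightarrow> bdd_above ((\<lambda>y. \<phi> y x) ` B)"
  shows "L-lipschitz_on S (\<lambda>x. Sup (insert c ((\<lambda>y. \<phi> y x) ` B)))"
proof (rule lipschitz_onI)
  let ?h = "\<lambda>x. Sup (insert c ((\<lambda>y. \<phi> y x) ` B))"
  have le: "?h x \<le> ?h x' + L * dist x x'" if xs: "x \<in> S" "x' \<in> S" for x x'
  proof (rule cSup_least)
    have bdd': "bdd_above (insert c ((\<lambda>y. \<phi> y x') ` B))"
      using bdd xs by simp
    fix v assume "v \<in> insert c ((\<lambda>y. \<phi> y x) ` B)"
    then consider "v = c" | y where "y \<in> B" "v = \<phi> y x" by auto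
    then show "v \<le> ?h x' + L * dist x x'"
    proof cases
      case 1
      have "c \<le> ?h x'" by (rule cSup_upper) (use bdd' in auto)
      then show ?thesis using 1 L by (simp add: add_increasing2)
    next
      case 2
      have "\<phi> y x' \<le> ?h x'" by (rule cSup_upper) (use bdd' 2 in auto)
      moreover have "\<phi> y x \<le> \<phi> y x' + L * dist x x'"
        using lipschitz_onD[OF lip[OF 2(1)] xs] by (simp add: dist_real_def)
      ultimately show ?thesis using 2 by linarith
    qed
  qed simp
  fix x x' assume "x \<in> S" "x' \<in> S"
  then show "dist (?h x) (?h x') \<le> L * dist x x'"
    using le[of x x'] le[of x' x] by (simp add: dist_real_def dist_commute abs_le_iff)
qed (rule L)

text \<open>
  The functions are the increments, along a well-order of \<open>S\<close>, of the tents
  \<open>max 0 (1 - dist x y / \<delta>)\<close>. The tents are uniformly Lipschitz, hence so are their running suprema,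
  which makes the increments continuous. The tent at \<open>y = x\<close> has value \<open>1\<close> at \<open>x\<close>, so the
  increments at \<open>x\<close> sum to \<open>1\<close>.
\<close>

lemma metric_partition_of_unity:
  fixes S :: "'x::metric_space set"
  assumes "0 < \<delta>"
  shows "\<exists>f :: 'x \<Rightarrow> 'x \<Rightarrow> real. (\<forall>y. continuous_on S (f y)) \<and> (\<forall>x y. 0 \<le> f y x) \<and>
    (\<forall>x y. f y x \<noteq> 0 \<longrightarrow> dist x y < \<delta>) \<and> (\<forall>x\<in>S. ((\<lambda>y. f y x) has_sum 1) S)"
proof -
  obtain r :: "'x rel" where r: "well_order_on S r"
    using well_order_on by blast
  define g where "g y x = max 0 (1 - dist x y / \<delta>)" for y x :: 'x
  define h where "h y x = Sup (insert 0 ((\<lambda>z. g z x) ` underS r y))" for y x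
  have lip: "(1 / \<delta>)-lipschitz_on S (g y)" for y
  proof (rule lipschitz_onI)
    fix x x' assume "x \<in> S" "x' \<in> S"
    have "dist (g y x) (g y x') \<le> \<bar>dist x y / \<delta> - dist x' y / \<delta>\<bar>"
      by (auto simp: g_def dist_real_def)
    also have "\<dots> = \<bar>dist x y - dist x' y\<bar> / \<delta>"
      using assms by (simp add: diff_divide_distrib[symmetric])
    also have "\<dots> \<le> dist x x' / \<delta>"
      using assms abs_dist_diff_le[of x y x'] by (intro divide_right_mono) (auto simp: dist_commute)
    finally show "dist (g y x) (g y x') \<le> 1 / \<delta> * dist x x'" by simp
  qed (use assms in simp)
  have g_le: "g y x \<le> 1" for x y
    using assms by (simp add: g_def)
  have "(1 / \<delta>)-lipschitz_on S (h y)" for y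
    unfolding h_def
    by (rule lipschitz_on_Sup_insert) (use lip assms g_le in \<open>auto intro!: bdd_aboveI2[where M = 1]\<close>)
  then have cont: "continuous_on S (\<lambda>x. max 0 (g y x - h y x))" for y
    using lip by (intro continuous_intros lipschitz_on_continuous_on)
  show ?thesis
  proof (intro exI[of _ "\<lambda>y x. max 0 (g y x - h y x)"] conjI allI ballI impI)
    show "continuous_on S (\<lambda>x. max 0 (g y x - h y x))" for y
      by (rule cont)
    fix x
    show "((\<lambda>y. max 0 (g y x - h y x)) has_sum 1) S" if "x \<in> S"
    proof -
      have "g x x = 1" by (simp add: g_def)
      then show ?thesis
        using has_sum_well_ordered_increments[OF r, of "\<lambda>y. g y x" x] that g_le
        by (simp add: h_def g_def[abs_def])
    qed
    fix y
    have "0 \<le> h y x"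
      unfolding h_def by (rule cSup_upper) (use g_le in \<open>auto intro!: bdd_aboveI2[where M = 1]\<close>)
    then show "dist x y < \<delta>" if "max 0 (g y x - h y x) \<noteq> 0"
    proof -
      have "0 < g y x" using that \<open>0 \<le> h y x\<close> by linarith
      then have "0 < 1 - dist x y / \<delta>" by (simp add: g_def)
      then show ?thesis using assms by simp
    qed
  qed simp
qed

section \<open>Averaging discontinuous maps\<close>

text \<open>
  The finite partial sums, divided by their total weight, are convex combinations, and these
  normalised sums converge to \<open>v\<close> because the weights sum to \<open>1\<close>.
\<close>

lemma has_sum_in_closure_convex_hull:
  fixes s :: "'i \<Rightarrow> 'y::real_normed_vector"
  assumes w: "(w has_sum 1) A" and nonneg: "\<And>y. y \<in> A \<Longrightarrow> 0 \<le> w y"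
    and v: "((\<lambda>y. w y *\<^sub>R s y) has_sum v) A"
  shows "v \<in> closure (convex hull (s ` {y\<in>A. w y \<noteq> 0}))"
proof -
  let ?C = "convex hull (s ` {y\<in>A. w y \<noteq> 0})"
  have w': "(sum w \<longlongrightarrow> 1) (finite_subsets_at_top A)"
    using w by (simp add: has_sum_def)
  have lim: "((\<lambda>F. inverse (sum w F) *\<^sub>R (\<Sum>y\<in>F. w y *\<^sub>R s y)) \<longlongrightarrow> inverse 1 *\<^sub>R v)
      (finite_subsets_at_top A)"
    using w' v unfolding has_sum_def by (intro tendsto_intros) auto
  have "\<forall>\<^sub>F F in finite_subsets_at_top A. 0 < sum w F"
    using w' by (rule order_tendstoD) simp
  moreover have "\<forall>\<^sub>F F in finite_subsets_at_top A. finite F \<and> F \<subseteq> A"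
    by (rule eventually_finite_subsets_at_top_weakI) auto
  ultimately have "\<forall>\<^sub>F F in finite_subsets_at_top A.
      inverse (sum w F) *\<^sub>R (\<Sum>y\<in>F. w y *\<^sub>R s y) \<in> closure ?C"
  proof eventually_elim
    case (elim F)
    let ?F = "{y\<in>F. w y \<noteq> 0}"
    have fin: "finite ?F" using elim by simp
    have sum_eq: "sum w F = sum w ?F" "(\<Sum>y\<in>F. w y *\<^sub>R s y) = (\<Sum>y\<in>?F. w y *\<^sub>R s y)"
      using elim by (auto intro!: sum.mono_neutral_right)
    have "(\<Sum>y\<in>?F. (w y / sum w F) *\<^sub>R s y) \<in> ?C"
    proof (rule convex_sum)
      show "(\<Sum>y\<in>?F. w y / sum w F) = 1"
        using elim by (simp add: sum_divide_distrib[symmetric] sum_eq[symmetric])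
    qed (use fin elim nonneg in \<open>auto intro!: divide_nonneg_pos hull_inc\<close>)
    moreover have "inverse (sum w F) *\<^sub>R (\<Sum>y\<in>F. w y *\<^sub>R s y) = (\<Sum>y\<in>?F. (w y / sum w F) *\<^sub>R s y)"
      unfolding sum_eq(2) scaleR_sum_right by (simp add: divide_inverse mult.commute)
    ultimately show ?case
      using closure_subset by auto
  qed
  then have "inverse 1 *\<^sub>R v \<in> closure ?C"
    by (rule Lim_in_closed_set[OF closed_closure _ _ lim]) simp
  then show ?thesis by simp
qed

text \<open>
  A bounded but otherwise arbitrary map \<open>s\<close> is smoothed by averaging it over a partition of unity.
  The last property expresses that \<open>F x\<close> lies in the closed convex hull of the values of \<open>s\<close> near \<open>x\<close>.
  Continuity comes from the constant total mass: the mass outside a finite set \<open>G\<close> of indices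
  is one minus a finite sum of continuous functions, so it stays small in a neighbourhood of any
  point where it is small.
\<close>

lemma continuous_local_average:
  fixes s :: "'x::metric_space \<Rightarrow> 'y::banach"
  assumes \<delta>: "0 < \<delta>" and s: "bounded (s ` S)"
  obtains F where "continuous_on S F"
    and "\<And>x Z. x \<in> S \<Longrightarrow> closed Z \<Longrightarrow> convex Z \<Longrightarrow>
      (\<And>y. y \<in> S \<Longrightarrow> dist x y < \<delta> \<Longrightarrow> s y \<in> Z) \<Longrightarrow> F x \<in> Z"
proof -
  obtain f :: "'x \<Rightarrow> 'x \<Rightarrow> real" where f:
    "(\<forall>y. continuous_on S (f y)) \<and> (\<forall>x y. 0 \<le> f y x) \<and>
    (\<forall>x y. f y x \<noteq> 0 \<longrightarrow> dist x y < \<delta>) \<and> (\<forall>x\<in>S. ((\<lambda>y. f y x) has_sum 1) S)"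
    using metric_partition_of_unity[OF \<delta>, of S] by (rule exE)
  have cont: "continuous_on S (f y)" and nonneg: "0 \<le> f y x"
    and support: "f y x \<noteq> 0 \<Longrightarrow> dist x y < \<delta>"
    and unity: "x \<in> S \<Longrightarrow> ((\<lambda>y. f y x) has_sum 1) S" for x y
    using f by simp_all
  obtain B where B: "0 < B" "\<And>y. y \<in> S \<Longrightarrow> norm (s y) \<le> B"
    using s unfolding bounded_pos by auto
  define F where "F x = (\<Sum>\<^sub>\<infinity>y\<in>S. f y x *\<^sub>R s y)" for x
  have fB: "((\<lambda>y. f y x * B) has_sum B) S" if "x \<in> S" for x
    using has_sum_cmult_left[OF unity[OF that], of B] by simp
  have term_le: "norm (f y x *\<^sub>R s y) \<le> f y x * B" if "y \<in> S" for x y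
    using B(2)[OF that] nonneg by (auto intro!: mult_left_mono)
  have F: "((\<lambda>y. f y x *\<^sub>R s y) has_sum F x) S" if x: "x \<in> S" for x
  proof -
    have "(\<lambda>y. norm (f y x *\<^sub>R s y)) summable_on S"
      by (rule summable_on_comparison_test[OF has_sum_imp_summable[OF fB[OF x]]])
        (rule term_le, assumption, rule norm_ge_zero)
    then show ?thesis
      unfolding F_def by (rule has_sum_infsum[OF abs_summable_summable])
  qed
  have tail: "norm (F x - (\<Sum>y\<in>G. f y x *\<^sub>R s y)) \<le> (1 - (\<Sum>y\<in>G. f y x)) * B"
    if x: "x \<in> S" and G: "finite G" "G \<subseteq> S" for x G
  proof -
    have "((\<lambda>y. f y x *\<^sub>R s y) has_sum (F x - (\<Sum>y\<in>G. f y x *\<^sub>R s y))) (S - G)"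
      by (rule has_sum_Diff[OF F[OF x] has_sum_finite]) (use G in auto)
    moreover have "((\<lambda>y. f y x * B) has_sum (B - (\<Sum>y\<in>G. f y x * B))) (S - G)"
      by (rule has_sum_Diff[OF fB[OF x] has_sum_finite]) (use G in auto)
    ultimately have "norm (F x - (\<Sum>y\<in>G. f y x *\<^sub>R s y)) \<le> B - (\<Sum>y\<in>G. f y x * B)"
      by (rule norm_infsum_le) (use term_le in auto)
    then show ?thesis
      by (simp add: sum_distrib_right left_diff_distrib)
  qed
  have "continuous_on S F"
    unfolding continuous_on_def tendsto_iff
  proof (intro ballI allI impI)
    fix x and e :: real assume x: "x \<in> S" and e: "0 < e"
    let ?P = "\<lambda>G x. \<Sum>y\<in>G. f y x *\<^sub>R s y"
    have "\<forall>\<^sub>F G in finite_subsets_at_top S. 1 - e / (2 * B) < (\<Sum>y\<in>G. f y x)"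
      using unity[OF x] e B(1) unfolding has_sum_def by (intro order_tendstoD) auto
    then obtain G where G: "finite G" "G \<subseteq> S" "1 - e / (2 * B) < (\<Sum>y\<in>G. f y x)"
      unfolding eventually_finite_subsets_at_top by blast
    \<comment> \<open>A continuous majorant of the distance to \<open>F x\<close>: the change of the finite part and both tails.\<close>
    define b where "b x' = norm (?P G x' - ?P G x) + (1 - (\<Sum>y\<in>G. f y x')) * B
        + (1 - (\<Sum>y\<in>G. f y x)) * B" for x'
    have "continuous_on S b"
      unfolding b_def using cont G by (intro continuous_intros) auto
    then have "(b \<longlongrightarrow> b x) (at x within S)"
      using x by (simp add: continuous_on_def)
    moreover have "b x < e"
      using G(3) B(1) by (simp add: b_def field_simps)
    ultimately have "\<forall>\<^sub>F x' in at x within S. b x' < e"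
      by (rule order_tendstoD)
    moreover have "\<forall>\<^sub>F x' in at x within S. x' \<in> S"
      by (auto simp: eventually_at_filter)
    ultimately show "\<forall>\<^sub>F x' in at x within S. dist (F x') (F x) < e"
    proof eventually_elim
      case (elim x')
      have "dist (F x') (F x) \<le> norm (?P G x' - ?P G x) + norm (F x' - ?P G x') + norm (F x - ?P G x)"
        unfolding dist_norm by (norm)
      also have "\<dots> \<le> b x'"
        unfolding b_def by (intro add_mono order_refl tail elim x G)
      finally show ?case using elim by simp
    qed
  qed
  moreover have "F x \<in> Z"
    if x: "x \<in> S" and Z: "closed Z" "convex Z"
      and near: "\<And>y. y \<in> S \<Longrightarrow> dist x y < \<delta> \<Longrightarrow> s y \<in> Z" for x Z
  proof -
    have "F x \<in> closure (convex hull (s ` {y\<in>S. f y x \<noteq> 0}))"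
      by (rule has_sum_in_closure_convex_hull[OF unity[OF x] nonneg F[OF x]])
    also have "\<dots> \<subseteq> Z"
      using near support by (intro closure_minimal hull_minimal Z) auto
    finally show ?thesis .
  qed
  ultimately show thesis by (rule that)
qed

text \<open>
  Since \<open>T (s y)\<close> is close to \<open>y\<close>, which is close to \<open>x\<close>, the average stays in the closed convex set
  of points that \<open>T\<close> maps near \<open>x\<close>.
\<close>

lemma continuous_approximate_right_inverse:
  fixes T :: "'y::banach \<Rightarrow> 'x::real_normed_vector"
  assumes T: "bounded_linear T" and \<delta>: "0 < \<delta>" and s: "bounded (s ` S)"
    and err: "\<And>y. y \<in> S \<Longrightarrow> norm (y - T (s y)) \<le> \<eta>"
  obtains F where "continuous_on S F"
    and "\<And>x. x \<in> S \<Longrightarrow> norm (x - T (F x)) \<le> \<delta> + \<eta>"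
    and "\<And>x Z. x \<in> S \<Longrightarrow> closed Z \<Longrightarrow> convex Z \<Longrightarrow> s ` S \<subseteq> Z \<Longrightarrow> F x \<in> Z"
proof (rule continuous_local_average[OF \<delta> s])
  fix F assume cont: "continuous_on S F"
    and F_in: "\<And>x Z. x \<in> S \<Longrightarrow> closed Z \<Longrightarrow> convex Z \<Longrightarrow>
      (\<And>y. y \<in> S \<Longrightarrow> dist x y < \<delta> \<Longrightarrow> s y \<in> Z) \<Longrightarrow> F x \<in> Z"
  have "norm (x - T (F x)) \<le> \<delta> + \<eta>" if x: "x \<in> S" for x
  proof -
    have "F x \<in> T -` cball x (\<delta> + \<eta>)"
    proof (rule F_in[OF x])
      show "closed (T -` cball x (\<delta> + \<eta>))"
        by (intro continuous_closed_vimage closed_cball linear_continuous_at T)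
      show "convex (T -` cball x (\<delta> + \<eta>))"
        by (intro convex_linear_vimage convex_cball bounded_linear.linear T)
      fix y assume "y \<in> S" "dist x y < \<delta>"
      moreover have "norm (x - T (s y)) \<le> norm (x - y) + norm (y - T (s y))"
        by norm
      ultimately show "s y \<in> T -` cball x (\<delta> + \<eta>)"
        using err[of y] by (auto simp: dist_norm)
    qed
    then show ?thesis by (simp add: dist_norm)
  qed
  moreover have "F x \<in> Z" if "x \<in> S" "closed Z" "convex Z" "s ` S \<subseteq> Z" for x Z
    using that by (intro F_in) auto
  ultimately show thesis by (rule that[OF cont])
qed

section \<open>Radial extension from the unit sphere\<close>

definition radial_extension :: "('x::real_normed_vector \<Rightarrow> 'y::real_normed_vector) \<Rightarrow> 'x \<Rightarrow> 'y" where
  "radial_extension f x = norm x *\<^sub>R f (sgn x)"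

lemma pos_homogeneous_radial_extension: "pos_homogeneous (radial_extension f)"
  unfolding pos_homogeneous_def
proof (intro allI impI)
  fix x :: 'a and c :: real assume "0 \<le> c"
  then show "radial_extension f (c *\<^sub>R x) = c *\<^sub>R radial_extension f x"
    by (cases "c = 0") (simp_all add: radial_extension_def sgn_scaleR)
qed

text \<open>
  Away from the origin \<open>sgn\<close> is continuous; at the origin, where it is not, boundedness of \<open>f\<close> makes
  the factor \<open>norm x\<close> prevail.
\<close>

lemma continuous_radial_extension:
  assumes cont: "continuous_on (sphere 0 1) f" and bdd: "bounded (f ` sphere 0 1)"
  shows "continuous_on UNIV (radial_extension f)"
proof -
  obtain B where B: "0 < B" "\<And>x. x \<in> sphere 0 1 \<Longrightarrow> norm (f x) \<le> B"
    using bdd unfolding bounded_pos by auto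
  have "continuous_on (- {0}) (radial_extension f)"
  proof -
    have "continuous_on (- {0}) (sgn :: 'a \<Rightarrow> 'a)"
      unfolding sgn_div_norm by (intro continuous_intros) auto
    then have "continuous_on (- {0}) (\<lambda>x. f (sgn x))"
      by (rule continuous_on_compose2[OF cont]) (auto simp: norm_sgn split: if_splits)
    then show ?thesis
      unfolding radial_extension_def[abs_def] by (intro continuous_intros)
  qed
  then have "isCont (radial_extension f) x" if "x \<noteq> 0" for x
    using that by (simp add: continuous_on_eq_continuous_at open_Compl)
  moreover have "isCont (radial_extension f) 0"
  proof -
    have le: "norm (radial_extension f x) \<le> norm x * B" for x
      by (cases "x = 0") (auto simp: radial_extension_def norm_sgn intro!: mult_left_mono B)
    have "((\<lambda>x::'a. norm x * B) \<longlongrightarrow> 0) (at 0)"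
      by (rule tendsto_eq_intros refl | simp)+
    then have "(radial_extension f \<longlongrightarrow> 0) (at 0)"
      by (rule Lim_null_comparison[rotated]) (simp add: le)
    then show ?thesis
      by (simp add: isCont_def radial_extension_def)
  qed
  ultimately have "isCont (radial_extension f) x" for x
    by (cases "x = 0") auto
  then show ?thesis
    by (simp add: continuous_on_eq_continuous_at)
qed

lemma radial_extension_in_cone:
  assumes "convex_cone E" "\<And>x. x \<in> sphere 0 1 \<Longrightarrow> f x \<in> E"
  shows "radial_extension f x \<in> E"
  using assms by (cases "x = 0")
    (auto simp: radial_extension_def norm_sgn intro!: convex_cone_scaleR convex_cone_contains_0)

section \<open>Right inverses with values in a closed cone\<close>

text \<open>
  The convex sets \<open>T ` (E \<inter> cball 0 n)\<close> cover the Banach space, so by Baire's theorem the closure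
  of one of them contains a ball around some \<open>x0\<close>. These sets need not be symmetric; adding one preimage
  \<open>y0 \<in> E\<close> of \<open>- x0\<close> moves the ball to the origin, and scaling gives the linear bound.
\<close>

lemma approximate_preimages_in_cone:
  fixes T :: "'y::real_normed_vector \<Rightarrow> 'x::banach"
  assumes T: "linear T" and E: "convex_cone E" and onto: "T ` E = UNIV"
  obtains M where "0 < M"
    and "\<And>x e. 0 < e \<Longrightarrow> \<exists>y\<in>E. norm y \<le> M * norm x \<and> norm (x - T y) < e"
proof -
  define A where "A n = T ` (E \<inter> cball 0 (real n))" for n
  have cover: "(\<Union>n. closure (A n)) = UNIV"
  proof -
    have "\<exists>n. x \<in> A n" for x
    proof -
      obtain y where y: "y \<in> E" "x = T y" using onto by (metis UNIV_I imageE)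
      obtain n where "norm y \<le> real n" using real_arch_simple by blast
      then show ?thesis using y by (intro exI[of _ n]) (simp add: A_def)
    qed
    then have "UNIV \<subseteq> (\<Union>n. A n)" by blast
    also have "\<dots> \<subseteq> (\<Union>n. closure (A n))" by (intro UN_mono closure_subset) simp
    finally show ?thesis by blast
  qed
  have "\<exists>n. interior (closure (A n)) \<noteq> {}"
  proof (rule ccontr)
    assume "\<not> ?thesis"
    then have "euclidean interior_of \<Union> (range (\<lambda>n. closure (A n))) = {}"
      by (intro Baire_category_alt) (auto simp: completely_metrizable_space_euclidean)
    then show False unfolding cover by simp
  qed
  then obtain n x0 where "x0 \<in> interior (closure (A n))"
    by blast
  then obtain r where r: "0 < r" "ball x0 r \<subseteq> closure (A n)"
    by (auto simp: mem_interior)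
  obtain y0 where y0: "y0 \<in> E" "- x0 = T y0"
    using onto by (metis UNIV_I imageE)
  \<comment> \<open>The summand \<open>1\<close> makes \<open>M\<close> positive even if \<open>n = 0\<close> and \<open>y0 = 0\<close>.\<close>
  define M where "M = 2 * (real n + norm y0 + 1) / r"
  show thesis
  proof
    show "0 < M"
      unfolding M_def using r(1) by (intro divide_pos_pos) (auto simp: add_nonneg_pos)
    fix x :: 'x and e :: real assume e: "0 < e"
    show "\<exists>y\<in>E. norm y \<le> M * norm x \<and> norm (x - T y) < e"
    proof (cases "x = 0")
      case True
      then show ?thesis
        using E T e by (intro bexI[of _ 0]) (auto simp: convex_cone_contains_0 linear_0)
    next
      case False
      define c where "c = r / (2 * norm x)"
      have c: "0 < c" using r(1) False by (simp add: c_def)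
      have "x0 + c *\<^sub>R x \<in> ball x0 r"
        using r(1) False by (simp add: c_def dist_norm)
      then have "x0 + c *\<^sub>R x \<in> closure (A n)"
        using r(2) by blast
      then obtain a where a: "a \<in> A n" "dist a (x0 + c *\<^sub>R x) < c * e"
        using c e unfolding closure_approachable by (meson mult_pos_pos)
      then obtain y where y: "y \<in> E" "norm y \<le> real n" "a = T y"
        by (auto simp: A_def)
      define z where "z = inverse c *\<^sub>R (y + y0)"
      have "z \<in> E"
        unfolding z_def using y y0 E c by (intro convex_cone_scaleR convex_cone_add) auto
      moreover have "norm z \<le> M * norm x"
      proof -
        have "norm (y + y0) \<le> real n + norm y0 + 1"
          using y(2) norm_triangle_ineq[of y y0] by linarith
        then have "norm z \<le> inverse c * (real n + norm y0 + 1)"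
          unfolding z_def using c by (simp add: mult_left_mono)
        also have "\<dots> = M * norm x"
          by (simp add: c_def M_def divide_simps)
        finally show ?thesis .
      qed
      moreover have "norm (x - T z) < e"
      proof -
        have "x - T z = inverse c *\<^sub>R ((x0 + c *\<^sub>R x) - a)"
          using T c y(3) y0(2)[symmetric]
          by (simp add: z_def linear_add linear_scale algebra_simps)
        then have "norm (x - T z) = dist a (x0 + c *\<^sub>R x) / c"
          using c by (simp add: dist_norm norm_minus_commute divide_inverse mult.commute)
        also have "\<dots> < e"
          using a(2) c by (simp add: divide_less_eq mult.commute)
        finally show ?thesis .
      qed
      ultimately show ?thesis by blast
    qed
  qed
qed

text \<open>
  A continuous version of the successive approximation in the open mapping theorem. Averaging
  approximate preimages on the sphere and extending radially gives a continuous positively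
  homogeneous \<open>G\<close> with values in \<open>E\<close> whose error \<open>R x = x - T (G x)\<close> has at most half the norm of
  \<open>x\<close>. Then \<open>T (G (R^n x)) = R^n x - R^(n+1) x\<close>, so \<open>T\<close> sends the sum of all corrections
  \<open>G (R^n x)\<close> to \<open>x\<close>. As \<open>E\<close> is closed under sums and limits, the sum stays in \<open>E\<close>.
\<close>

lemma closed_cone_continuous_right_inverse:
  fixes T :: "'y::banach \<Rightarrow> 'x::banach"
  assumes T: "bounded_linear T" and E: "convex_cone E" and "closed E" and onto: "T ` E = UNIV"
  obtains \<gamma> M where "0 < M" "continuous_on UNIV \<gamma>" "pos_homogeneous \<gamma>"
    "\<And>x. \<gamma> x \<in> E" "\<And>x. T (\<gamma> x) = x" "\<And>x. norm (\<gamma> x) \<le> M * norm x"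
proof -
  interpret T: bounded_linear T by (rule T)
  have convex: "convex E" using E by (simp add: convex_cone_def)
  obtain M where M: "0 < M"
    and approx: "\<And>x e. 0 < e \<Longrightarrow> \<exists>y\<in>E. norm y \<le> M * norm x \<and> norm (x - T y) < e"
    using approximate_preimages_in_cone[OF T.linear_axioms E onto] by metis
  define S where "S = sphere (0::'x) 1"
  \<comment> \<open>An error \<open>1 / 4\<close> here and averaging radius \<open>1 / 4\<close> add up to the contraction factor \<open>1 / 2\<close>.\<close>
  have "\<forall>x\<in>S. \<exists>y\<in>E. norm y \<le> M \<and> norm (x - T y) < 1 / 4"
    using approx[of "1 / 4"] by (force simp: S_def)
  then obtain s where s: "\<And>x. x \<in> S \<Longrightarrow> s x \<in> E" "\<And>x. x \<in> S \<Longrightarrow> norm (s x) \<le> M"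
    "\<And>x. x \<in> S \<Longrightarrow> norm (x - T (s x)) < 1 / 4"
    by metis
  have "bounded (s ` S)"
    using s(2) by (auto simp: bounded_iff)
  moreover have "norm (x - T (s x)) \<le> 1 / 4" if "x \<in> S" for x
    using s(3)[OF that] by simp
  ultimately obtain F where contF: "continuous_on S F"
    and FT: "\<And>x. x \<in> S \<Longrightarrow> norm (x - T (F x)) \<le> 1 / 4 + 1 / 4"
    and F_in: "\<And>x Z. x \<in> S \<Longrightarrow> closed Z \<Longrightarrow> convex Z \<Longrightarrow> s ` S \<subseteq> Z \<Longrightarrow> F x \<in> Z"
    using continuous_approximate_right_inverse[OF T, of "1 / 4" s S "1 / 4"] by auto
  have FE: "F x \<in> E" if "x \<in> S" for x
    using s(1) by (intro F_in[OF that \<open>closed E\<close> convex]) auto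
  have FM: "norm (F x) \<le> M" if "x \<in> S" for x
  proof -
    have "F x \<in> cball 0 M"
      using s(2) by (intro F_in[OF that]) auto
    then show ?thesis by simp
  qed
  have "bounded (F ` S)"
    using FM by (auto simp: bounded_iff)
  define G where "G = radial_extension F"
  define R where "R x = x - T (G x)" for x
  have contG: "continuous_on UNIV G"
    unfolding G_def using contF \<open>bounded (F ` S)\<close> by (intro continuous_radial_extension) (auto simp: S_def)
  have GE: "G x \<in> E" for x
    unfolding G_def using E FE by (intro radial_extension_in_cone) (auto simp: S_def)
  have sgn_S: "sgn x \<in> S" if "x \<noteq> 0" for x
    using that by (simp add: S_def norm_sgn)
  have GM: "norm (G x) \<le> M * norm x" for x
    using FM[OF sgn_S[of x]] by (cases "x = 0") (auto simp: G_def radial_extension_def mult.commute mult_left_mono)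
  have RM: "norm (R x) \<le> norm x / 2" for x
  proof (cases "x = 0")
    case False
    have "x = norm x *\<^sub>R sgn x" using False by (simp add: sgn_div_norm)
    then have "R x = norm x *\<^sub>R (sgn x - T (F (sgn x)))"
      unfolding R_def G_def radial_extension_def by (simp add: T.scaleR scaleR_diff_right)
    then show ?thesis
      using FT[OF sgn_S[OF False]] mult_left_mono[of _ "1/2" "norm x"] by fastforce
  qed (simp add: R_def G_def radial_extension_def)
  have hom: "G (c *\<^sub>R x) = c *\<^sub>R G x" "R (c *\<^sub>R x) = c *\<^sub>R R x" if "0 \<le> c" for c x
    using pos_homogeneous_radial_extension[of F] that
    by (auto simp: pos_homogeneous_def R_def G_def T.scaleR scaleR_diff_right)
  have contR: "continuous_on UNIV R"
    unfolding R_def by (intro continuous_intros contG T.continuous_on)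
  have RnM: "norm ((R ^^ n) x) \<le> (1 / 2) ^ n * norm x" for n x
  proof (induction n)
    case (Suc n)
    then show ?case using RM[of "(R ^^ n) x"] by simp
  qed simp
  have contRn: "continuous_on UNIV (R ^^ n)" for n
  proof (induction n)
    case (Suc n)
    then show ?case
      using continuous_on_compose[OF Suc continuous_on_subset[OF contR]] by simp
  qed (simp add: id_def)
  have homRn: "(R ^^ n) (c *\<^sub>R x) = c *\<^sub>R (R ^^ n) x" if "0 \<le> c" for n c x
    by (induction n) (simp_all add: hom that)
  define g where "g n x = G ((R ^^ n) x)" for n x
  have gM: "norm (g n x) \<le> M * norm x * (1 / 2) ^ n" for n x
  proof -
    have "norm (g n x) \<le> M * norm ((R ^^ n) x)"
      unfolding g_def by (rule GM)
    also have "\<dots> \<le> M * ((1 / 2) ^ n * norm x)"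
      using M RnM by (intro mult_left_mono) auto
    finally show ?thesis by (simp add: mult_ac)
  qed
  have geometric: "summable (\<lambda>n. C * (1 / 2 :: real) ^ n)" for C
    by (intro summable_mult summable_geometric) simp
  have summable: "summable (\<lambda>n. g n x)" for x
    by (rule summable_comparison_test'[OF geometric gM])
  define \<gamma> where "\<gamma> x = (\<Sum>n. g n x)" for x
  have contg: "continuous_on UNIV (g n)" for n
    unfolding g_def by (rule continuous_on_compose2[OF contG contRn]) simp
  show thesis
  proof
    show "0 < 2 * M" using M by simp
    have "continuous_on (ball 0 r) \<gamma>" for r
    proof (rule uniform_limit_theorem)
      show "uniform_limit (ball 0 r) (\<lambda>n x. \<Sum>i<n. g i x) \<gamma> sequentially"
        unfolding \<gamma>_def
      proof (rule Weierstrass_m_test[OF _ geometric[of "M * r"]])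
        fix n x assume "x \<in> ball (0::'x) r"
        then have "M * norm x * (1 / 2) ^ n \<le> M * r * (1 / 2) ^ n"
          using M by (intro mult_right_mono mult_left_mono) auto
        then show "norm (g n x) \<le> M * r * (1 / 2) ^ n"
          using gM order_trans by blast
      qed
      show "\<forall>\<^sub>F n in sequentially. continuous_on (ball 0 r) (\<lambda>x. \<Sum>i<n. g i x)"
        by (intro always_eventually allI continuous_intros continuous_on_subset[OF contg]) simp
    qed simp
    then have "isCont \<gamma> x" for x
      using continuous_on_eq_continuous_at[OF open_ball, of 0 "norm x + 1" \<gamma>] by force
    then show "continuous_on UNIV \<gamma>"
      by (simp add: continuous_on_eq_continuous_at)
    show "pos_homogeneous \<gamma>"
      unfolding pos_homogeneous_def \<gamma>_def g_def
      using summable by (auto simp: homRn hom suminf_scaleR_right g_def)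
    show "norm (\<gamma> x) \<le> 2 * M * norm x" for x
    proof -
      have "norm (\<gamma> x) \<le> (\<Sum>n. M * norm x * (1 / 2) ^ n)"
        unfolding \<gamma>_def by (rule norm_suminf_le[OF gM geometric])
      also have "\<dots> = 2 * M * norm x"
        by (subst suminf_mult) (simp_all add: suminf_geometric summable_geometric)
      finally show ?thesis .
    qed
    show "\<gamma> x \<in> E" for x
    proof (rule Lim_in_closed_set[OF \<open>closed E\<close>])
      show "(\<lambda>n. \<Sum>i<n. g i x) \<longlonglongrightarrow> \<gamma> x"
        unfolding \<gamma>_def by (rule summable_LIMSEQ[OF summable])
      have "(\<Sum>i<n. g i x) \<in> E" for n
        by (induction n) (auto simp: g_def GE convex_cone_add[OF E] convex_cone_contains_0[OF E])
      then show "\<forall>\<^sub>F n in sequentially. (\<Sum>i<n. g i x) \<in> E"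
        by simp
    qed simp
    show "T (\<gamma> x) = x" for x
    proof -
      have "(\<lambda>n. (R ^^ n) x) \<longlonglongrightarrow> 0"
      proof (rule Lim_null_comparison)
        show "(\<lambda>n. (1 / 2) ^ n * norm x) \<longlonglongrightarrow> 0"
          by (intro tendsto_mult_left_zero LIMSEQ_realpow_zero) auto
      qed (simp add: RnM)
      then have "(\<lambda>n. (R ^^ n) x - (R ^^ Suc n) x) sums ((R ^^ 0) x - 0)"
        by (rule telescope_sums')
      moreover have "T (g n x) = (R ^^ n) x - (R ^^ Suc n) x" for n
        by (simp add: g_def R_def)
      moreover have "(\<lambda>n. T (g n x)) sums T (\<gamma> x)"
        unfolding \<gamma>_def by (intro T.sums summable_sums summable)
      ultimately show ?thesis
        by (simp add: sums_unique2)
    qed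
  qed
qed

section \<open>Right inverses subject to sublinear bounds\<close>

text \<open>
  Seminorms, linear functionals and \<open>norm (fst p) + norm (snd p)\<close> share two properties on which the
  argument rests: their sublevel sets are convex, and adding a correction to the argument raises the
  value by at most the value of the correction.
\<close>

definition sublinear_functional :: "('y::real_vector \<Rightarrow> real) \<Rightarrow> bool" where
  "sublinear_functional q \<longleftrightarrow>
    (\<forall>y z. q (y + z) \<le> q y + q z) \<and> (\<forall>y. \<forall>c\<ge>0. q (c *\<^sub>R y) = c * q y)"

lemma sublinear_functional_linear: "linear q \<Longrightarrow> sublinear_functional q"
  by (simp add: sublinear_functional_def linear_add linear_scale)

lemma sublinear_functional_seminorm: "seminorm q \<Longrightarrow> sublinear_functional q"
  by (simp add: sublinear_functional_def seminorm_def)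

lemma convex_sublevel_sublinear:
  assumes "sublinear_functional q"
  shows "convex {y. q y \<le> b}"
proof (rule convexI)
  fix y z and u v :: real
  assume yz: "y \<in> {y. q y \<le> b}" "z \<in> {y. q y \<le> b}" and uv: "0 \<le> u" "0 \<le> v" "u + v = 1"
  have "q (u *\<^sub>R y + v *\<^sub>R z) \<le> u * q y + v * q z"
    using assms uv unfolding sublinear_functional_def by metis
  also have "\<dots> \<le> b"
    using yz uv by (intro convex_bound_le) auto
  finally show "u *\<^sub>R y + v *\<^sub>R z \<in> {y. q y \<le> b}" by simp
qed

text \<open>
  Averaging \<open>s\<close> preserves all the bounds, because they define closed convex sets, but only solves
  \<open>T (F x) = x\<close> up to \<open>\<delta>\<close>. A continuous right inverse \<open>g\<close>, with whatever constant \<open>M\<close>, repairs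
  this small error exactly; by sublinearity the repair adds to each \<open>q i\<close> at most its value
  at a point of norm at most \<open>M * \<delta>\<close>, which is less than \<open>e\<close> for small \<open>\<delta>\<close>.
\<close>

lemma closed_cone_continuous_right_inverse_bounds:
  fixes T :: "'y::banach \<Rightarrow> 'x::banach" and q :: "'i \<Rightarrow> 'y \<Rightarrow> real"
  assumes T: "bounded_linear T" and E: "convex_cone E" and "closed E" and onto: "T ` E = UNIV"
    and "finite I"
    and q: "\<And>i. i \<in> I \<Longrightarrow> sublinear_functional (q i)"
    and cont_q: "\<And>i. i \<in> I \<Longrightarrow> continuous_on UNIV (q i)"
    and s: "\<And>x. x \<in> sphere 0 1 \<Longrightarrow> s x \<in> E" "\<And>x. x \<in> sphere 0 1 \<Longrightarrow> T (s x) = x"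
    and bounded_s: "bounded (s ` sphere 0 1)"
    and s_le: "\<And>x i. x \<in> sphere 0 1 \<Longrightarrow> i \<in> I \<Longrightarrow> q i (s x) \<le> \<beta> i"
    and e: "0 < e"
  obtains \<gamma> where "continuous_on UNIV \<gamma>" "pos_homogeneous \<gamma>"
    "\<And>x. \<gamma> x \<in> E" "\<And>x. T (\<gamma> x) = x"
    "\<And>x i. i \<in> I \<Longrightarrow> q i (\<gamma> x) \<le> (\<beta> i + e) * norm x"
proof -
  interpret T: bounded_linear T by (rule T)
  obtain g M where M: "0 < M" and g: "continuous_on UNIV g" "\<And>x. g x \<in> E" "\<And>x. T (g x) = x"
    and gM: "\<And>x. norm (g x) \<le> M * norm x"
    using closed_cone_continuous_right_inverse[OF T E \<open>closed E\<close> onto] by metis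
  have "\<forall>\<^sub>F y in nhds 0. \<forall>i\<in>I. q i y < e"
  proof (rule eventually_ball_finite[OF \<open>finite I\<close>], rule ballI)
    fix i assume i: "i \<in> I"
    have "q i 0 = 0"
      using q[OF i] unfolding sublinear_functional_def by (metis mult_zero_left order_refl scale_zero_left)
    moreover have "(q i \<longlongrightarrow> q i 0) (nhds 0)"
      using cont_q[OF i] by (auto simp: continuous_on_eq_continuous_at isCont_def tendsto_at_iff_tendsto_nhds)
    ultimately show "\<forall>\<^sub>F y in nhds 0. q i y < e"
      using e by (intro order_tendstoD(2)) auto
  qed
  then obtain d where d: "0 < d" "\<And>y i. norm y < d \<Longrightarrow> i \<in> I \<Longrightarrow> q i y < e"
    unfolding eventually_nhds_metric by (auto simp: dist_norm)
  define \<delta> where "\<delta> = d / (2 * M)"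
  have \<delta>: "0 < \<delta>" using d M by (simp add: \<delta>_def)
  obtain F where contF: "continuous_on (sphere 0 1) F"
    and FT: "\<And>x. x \<in> sphere 0 1 \<Longrightarrow> norm (x - T (F x)) \<le> \<delta> + 0"
    and F_in: "\<And>x Z. x \<in> sphere 0 1 \<Longrightarrow> closed Z \<Longrightarrow> convex Z \<Longrightarrow> s ` sphere 0 1 \<subseteq> Z \<Longrightarrow> F x \<in> Z"
    using continuous_approximate_right_inverse[OF T \<delta> bounded_s, of 0] s(2) by auto
  define h where "h x = F x + g (x - T (F x))" for x
  have hE: "h x \<in> E" if "x \<in> sphere 0 1" for x
    unfolding h_def using E s(1)
    by (intro convex_cone_add[OF E] g F_in[OF that \<open>closed E\<close>]) (auto simp: convex_cone_def)
  have hT: "T (h x) = x" for x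
    by (simp add: h_def T.add g)
  have small: "norm (g (x - T (F x))) < d" if "x \<in> sphere 0 1" for x
  proof -
    have "norm (g (x - T (F x))) \<le> M * \<delta>"
      using M FT[OF that] by (intro order_trans[OF gM] mult_left_mono) auto
    also have "\<dots> < d" using M d by (simp add: \<delta>_def)
    finally show ?thesis .
  qed
  have hq: "q i (h x) \<le> \<beta> i + e" if x: "x \<in> sphere 0 1" and i: "i \<in> I" for x i
  proof -
    have "closed {y. q i y \<le> \<beta> i}"
      by (intro closed_Collect_le cont_q i continuous_on_const)
    then have "F x \<in> {y. q i y \<le> \<beta> i}"
      using s_le i by (intro F_in[OF x] convex_sublevel_sublinear q) auto
    moreover have "q i (h x) \<le> q i (F x) + q i (g (x - T (F x)))"
      using q[OF i] by (simp add: h_def sublinear_functional_def)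
    ultimately show ?thesis
      using d(2)[OF small[OF x] i] by simp
  qed
  have bounded_h: "bounded (h ` sphere 0 1)"
  proof -
    obtain B where B: "\<And>x. x \<in> sphere 0 1 \<Longrightarrow> norm (s x) \<le> B"
      using bounded_s unfolding bounded_iff by blast
    have "norm (h x) \<le> B + d" if x: "x \<in> sphere 0 1" for x
    proof -
      have "F x \<in> cball 0 B"
        using B by (intro F_in[OF x]) auto
      then show ?thesis
        using small[OF x] norm_triangle_ineq[of "F x" "g (x - T (F x))"] by (simp add: h_def)
    qed
    then show ?thesis unfolding bounded_iff by blast
  qed
  have cont_h: "continuous_on (sphere 0 1) h"
    unfolding h_def
    by (intro continuous_intros contF T.continuous_on continuous_on_compose2[OF g(1)]) auto
  show thesis
  proof
    show "continuous_on UNIV (radial_extension h)"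
      by (rule continuous_radial_extension[OF cont_h bounded_h])
    show "pos_homogeneous (radial_extension h)"
      by (rule pos_homogeneous_radial_extension)
    show "radial_extension h x \<in> E" for x
      by (rule radial_extension_in_cone[OF E hE])
    show "T (radial_extension h x) = x" for x
      by (cases "x = 0") (simp_all add: radial_extension_def T.scaleR hT sgn_div_norm)
    show "q i (radial_extension h x) \<le> (\<beta> i + e) * norm x" if i: "i \<in> I" for x i
    proof -
      have "q i (radial_extension h x) = norm x * q i (h (sgn x))"
        using q[OF i] by (simp add: radial_extension_def sublinear_functional_def)
      also have "\<dots> \<le> norm x * (\<beta> i + e)"
        using hq[OF _ i, of "sgn x"] by (cases "x = 0") (auto simp: norm_sgn intro!: mult_left_mono)
      finally show ?thesis by (simp add: mult.commute)
    qed
  qed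
qed

section \<open>Decomposition into differences of positive elements\<close>

lemma norm_le_sum_norms: "norm p \<le> norm (fst p) + norm (snd p)"
  by (cases p) (simp add: norm_Pair_le)

lemma sublinear_functional_sum_norms:
  "sublinear_functional (\<lambda>p::'a::real_normed_vector \<times> 'a. norm (fst p) + norm (snd p))"
  unfolding sublinear_functional_def
proof (intro conjI allI impI)
  fix p p' :: "'a \<times> 'a"
  show "norm (fst (p + p')) + norm (snd (p + p'))
      \<le> norm (fst p) + norm (snd p) + (norm (fst p') + norm (snd p'))"
    using norm_triangle_ineq[of "fst p" "fst p'"] norm_triangle_ineq[of "snd p" "snd p'"] by simp
qed (simp add: distrib_left)

lemma pos_homogeneous_fst: "pos_homogeneous \<gamma> \<Longrightarrow> pos_homogeneous (\<lambda>x. fst (\<gamma> x))"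
  by (simp add: pos_homogeneous_def)

lemma pos_homogeneous_snd: "pos_homogeneous \<gamma> \<Longrightarrow> pos_homogeneous (\<lambda>x. snd (\<gamma> x))"
  by (simp add: pos_homogeneous_def)

theorem theorem1p4:
  fixes Xp :: "'a::banach set"
    and J :: "'j set"
    and \<rho> :: "'j \<Rightarrow> 'a \<times> 'a \<Rightarrow> real"
  assumes "convex_cone Xp" and "closed Xp" and "generating Xp"
    and "finite J"
    and "\<And>j. j \<in> J \<Longrightarrow> continuous_on UNIV (\<rho> j) \<and> (seminorm (\<rho> j) \<or> linear (\<rho> j))"
  shows
    "(\<exists>K>0. \<exists>\<gamma>p \<gamma>m :: 'a \<Rightarrow> 'a.
        \<gamma>p \<in> UNIV \<rightarrow> Xp \<and> \<gamma>m \<in> UNIV \<rightarrow> Xp \<and>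
        continuous_on UNIV \<gamma>p \<and> continuous_on UNIV \<gamma>m \<and>
        pos_homogeneous \<gamma>p \<and> pos_homogeneous \<gamma>m \<and>
        (\<forall>x. x = \<gamma>p x - \<gamma>m x) \<and>
        (\<forall>x. norm (\<gamma>p x) + norm (\<gamma>m x) \<le> K * norm x))
     \<and>
     (\<forall>K>0. \<forall>\<alpha> :: 'j \<Rightarrow> real.
        (\<forall>\<epsilon>>0. \<exists>\<gamma>p \<gamma>m :: 'a \<Rightarrow> 'a.
           \<gamma>p \<in> sphere 0 1 \<rightarrow> Xp \<and> \<gamma>m \<in> sphere 0 1 \<rightarrow> Xp \<and>
           (\<forall>x\<in>sphere 0 1. x = \<gamma>p x - \<gamma>m x) \<and>
           (\<forall>x\<in>sphere 0 1. norm (\<gamma>p x) + norm (\<gamma>m x) \<le> K + \<epsilon>) \<and>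
           (\<forall>x\<in>sphere 0 1. \<forall>j\<in>J. \<rho> j (\<gamma>p x, \<gamma>m x) \<le> \<alpha> j + \<epsilon>))
        \<longleftrightarrow>
        (\<forall>\<epsilon>>0. \<exists>\<gamma>p \<gamma>m :: 'a \<Rightarrow> 'a.
           \<gamma>p \<in> UNIV \<rightarrow> Xp \<and> \<gamma>m \<in> UNIV \<rightarrow> Xp \<and>
           continuous_on UNIV \<gamma>p \<and> continuous_on UNIV \<gamma>m \<and>
           pos_homogeneous \<gamma>p \<and> pos_homogeneous \<gamma>m \<and>
           (\<forall>x. x = \<gamma>p x - \<gamma>m x) \<and>
           (\<forall>x. norm (\<gamma>p x) + norm (\<gamma>m x) \<le> (K + \<epsilon>) * norm x) \<and>
           (\<forall>x. \<forall>j\<in>J. \<rho> j (\<gamma>p x, \<gamma>m x) \<le> (\<alpha> j + \<epsilon>) * norm x)))"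
    (is "?decomposition \<and> (\<forall>K>0. \<forall>\<alpha>. (\<forall>\<epsilon>>0. ?pointwise K \<alpha> \<epsilon>) \<longleftrightarrow> (\<forall>\<epsilon>>0. ?continuous K \<alpha> \<epsilon>))")
proof -
  define T :: "'a \<times> 'a \<Rightarrow> 'a" where "T p = fst p - snd p" for p
  have T: "bounded_linear T"
    unfolding T_def by (intro bounded_linear_sub bounded_linear_fst bounded_linear_snd)
  have E: "convex_cone (Xp \<times> Xp)"
    using assms(1) unfolding convex_cone_iff by (simp add: mem_Times_iff)
  have closed_E: "closed (Xp \<times> Xp)"
    using assms(2) by (intro closed_Times)
  have onto: "T ` (Xp \<times> Xp) = UNIV"
    using assms(3) unfolding generating_def T_def by force
  have sublinear_\<rho>: "sublinear_functional (\<rho> j)" if "j \<in> J" for j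
    using assms(5)[OF that] sublinear_functional_linear sublinear_functional_seminorm by blast
  have decomposition: ?decomposition
  proof -
    obtain \<gamma> M where M: "0 < M" and \<gamma>: "continuous_on UNIV \<gamma>" "pos_homogeneous \<gamma>"
      "\<And>x. \<gamma> x \<in> Xp \<times> Xp" "\<And>x. T (\<gamma> x) = x" and \<gamma>M: "\<And>x. norm (\<gamma> x) \<le> M * norm x"
      using closed_cone_continuous_right_inverse[OF T E closed_E onto] by metis
    have "norm (fst (\<gamma> x)) + norm (snd (\<gamma> x)) \<le> (2 * M) * norm x" for x
      using \<gamma>M[of x] norm_fst_le[of "fst (\<gamma> x)" "snd (\<gamma> x)"]
        norm_snd_le[of "snd (\<gamma> x)" "fst (\<gamma> x)"] by simp
    moreover have "fst (\<gamma> x) \<in> Xp" "snd (\<gamma> x) \<in> Xp" "x = fst (\<gamma> x) - snd (\<gamma> x)" for x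
      using \<gamma>(3)[of x] \<gamma>(4)[of x] by (auto simp: T_def mem_Times_iff)
    ultimately show ?thesis
      using M \<gamma>
      by - (rule exI[of _ "2 * M"], rule conjI, simp,
        rule exI[of _ "\<lambda>x. fst (\<gamma> x)"], rule exI[of _ "\<lambda>x. snd (\<gamma> x)"],
        auto intro!: continuous_intros pos_homogeneous_fst pos_homogeneous_snd)
  qed
  have to_continuous: "?continuous K \<alpha> \<epsilon>" if pointwise: "?pointwise K \<alpha> (\<epsilon> / 2)" and "0 < \<epsilon>" for K \<alpha> \<epsilon>
  proof -
    obtain sp sm where pw: "sp \<in> sphere 0 1 \<rightarrow> Xp" "sm \<in> sphere 0 1 \<rightarrow> Xp"
      "\<forall>x\<in>sphere 0 1. x = sp x - sm x"
      "\<forall>x\<in>sphere 0 1. norm (sp x) + norm (sm x) \<le> K + \<epsilon> / 2"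
      "\<forall>x\<in>sphere 0 1. \<forall>j\<in>J. \<rho> j (sp x, sm x) \<le> \<alpha> j + \<epsilon> / 2"
      using pointwise by (elim exE conjE) (rule that)
    note s = funcset_mem[OF pw(1)] funcset_mem[OF pw(2)] pw(3)[rule_format]
    note sK = pw(4)[rule_format] and s\<rho> = pw(5)[rule_format]
    \<comment> \<open>The index \<open>None\<close> carries the sum of norms, so that one family contains all the bounds.\<close>
    define I where "I = insert None (Some ` J)"
    define q where "q i p = (case i of None \<Rightarrow> norm (fst p) + norm (snd p) | Some j \<Rightarrow> \<rho> j p)"
      for i and p :: "'a \<times> 'a"
    define \<beta> where "\<beta> i = (case i of None \<Rightarrow> K | Some j \<Rightarrow> \<alpha> j) + \<epsilon> / 2" for i
    have q_None: "q None = (\<lambda>p. norm (fst p) + norm (snd p))" and q_Some: "q (Some j) = \<rho> j" for j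
      by (simp_all add: q_def fun_eq_iff)
    obtain \<gamma> where \<gamma>: "continuous_on UNIV \<gamma>" "pos_homogeneous \<gamma>" "\<And>x. \<gamma> x \<in> Xp \<times> Xp"
      "\<And>x. T (\<gamma> x) = x" and \<gamma>q: "\<And>x i. i \<in> I \<Longrightarrow> q i (\<gamma> x) \<le> (\<beta> i + \<epsilon> / 2) * norm x"
    proof (rule closed_cone_continuous_right_inverse_bounds[OF T E closed_E onto,
          of I q "\<lambda>x. (sp x, sm x)" \<beta> "\<epsilon> / 2"])
      show "finite I" using assms(4) by (simp add: I_def)
      show "sublinear_functional (q i)" if "i \<in> I" for i
        using that sublinear_\<rho> unfolding I_def
        by (auto simp: q_None q_Some sublinear_functional_sum_norms)
      show "continuous_on UNIV (q i)" if "i \<in> I" for i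
        using that assms(5) unfolding I_def
        by (auto simp: q_None q_Some intro!: continuous_intros)
      show "bounded ((\<lambda>x. (sp x, sm x)) ` sphere 0 1)"
        unfolding bounded_iff
      proof (intro exI ballI)
        fix p assume "p \<in> (\<lambda>x. (sp x, sm x)) ` sphere 0 1"
        then show "norm p \<le> K + \<epsilon> / 2"
          using sK norm_le_sum_norms[of p] by fastforce
      qed
      show "q i (sp x, sm x) \<le> \<beta> i" if "x \<in> sphere 0 1" "i \<in> I" for x i
        using that sK s\<rho> by (auto simp: I_def q_def \<beta>_def)
    qed (use s \<open>0 < \<epsilon>\<close> in \<open>auto simp: T_def\<close>)
    have "norm (fst (\<gamma> x)) + norm (snd (\<gamma> x)) \<le> (K + \<epsilon>) * norm x" for x
      using \<gamma>q[of None x] by (simp add: I_def q_def \<beta>_def add.commute)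
    moreover have "\<rho> j (fst (\<gamma> x), snd (\<gamma> x)) \<le> (\<alpha> j + \<epsilon>) * norm x" if "j \<in> J" for j x
      using \<gamma>q[of "Some j" x] that by (simp add: I_def q_def \<beta>_def add.commute)
    moreover have "fst (\<gamma> x) \<in> Xp" "snd (\<gamma> x) \<in> Xp" "x = fst (\<gamma> x) - snd (\<gamma> x)" for x
      using \<gamma>(3)[of x] \<gamma>(4)[of x] by (auto simp: T_def mem_Times_iff)
    ultimately show ?thesis
      using \<gamma>
      by - (rule exI[of _ "\<lambda>x. fst (\<gamma> x)"], rule exI[of _ "\<lambda>x. snd (\<gamma> x)"],
        auto intro!: continuous_intros pos_homogeneous_fst pos_homogeneous_snd)
  qed
  have to_pointwise: "?pointwise K \<alpha> \<epsilon>" if continuous: "?continuous K \<alpha> \<epsilon>" for K \<alpha> \<epsilon>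
  proof -
    obtain \<gamma>p \<gamma>m :: "'a \<Rightarrow> 'a" where
      range: "\<gamma>p \<in> UNIV \<rightarrow> Xp" "\<gamma>m \<in> UNIV \<rightarrow> Xp" and diff: "\<forall>x. x = \<gamma>p x - \<gamma>m x"
      and norms: "\<forall>x. norm (\<gamma>p x) + norm (\<gamma>m x) \<le> (K + \<epsilon>) * norm x"
      and bounds: "\<forall>x. \<forall>j\<in>J. \<rho> j (\<gamma>p x, \<gamma>m x) \<le> (\<alpha> j + \<epsilon>) * norm x"
      using continuous by (elim exE conjE) (rule that)
    have "norm (\<gamma>p x) + norm (\<gamma>m x) \<le> K + \<epsilon>" "\<forall>j\<in>J. \<rho> j (\<gamma>p x, \<gamma>m x) \<le> \<alpha> j + \<epsilon>"
      if "x \<in> sphere 0 1" for x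
      using norms[rule_format, of x] bounds[rule_format, of _ x] that by auto
    then show ?thesis
      using range diff by - (rule exI[of _ \<gamma>p], rule exI[of _ \<gamma>m], auto)
  qed
  show ?thesis
  proof (intro conjI allI impI iffI)
    show ?decomposition by (rule decomposition)
    fix K :: real and \<alpha> :: "'j \<Rightarrow> real" and \<epsilon> :: real
    assume \<epsilon>: "0 < \<epsilon>"
    show "?continuous K \<alpha> \<epsilon>" if pointwise: "\<forall>\<epsilon>>0. ?pointwise K \<alpha> \<epsilon>"
      by (rule to_continuous[OF pointwise[THEN spec, THEN mp] \<epsilon>]) (use \<epsilon> in simp)
    show "?pointwise K \<alpha> \<epsilon>" if continuous: "\<forall>\<epsilon>>0. ?continuous K \<alpha> \<epsilon>"
      by (rule to_pointwise[OF continuous[THEN spec, THEN mp, OF \<epsilon>]])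
  qed
qed

end
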